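(* For every admissible choice of the finite covers and of the anchors made during its execution, the non-halting RC-algorithm (described in the context) produces an infinite sequence $\{\mathbf{c}_k\}_{k\in\mathbb{N}}\subseteq X$ such that $\mathbf{c}_k\to\mathbf{s}$ as $k\to\infty$, i.e. $\rho(\mathbf{c}_k;\mathbf{s})\to0$.
   Context: Sound ranging problem (SRP). $(X;\rho)$ is a metric space, $B[\mathbf{c};r]=\{\mathbf{x}\in X\mid\rho(\mathbf{x};\mathbf{c})\leq r\}$, $B(\mathbf{c};r)=\{\mathbf{x}\in X\mid\rho(\mathbf{x};\mathbf{c})<r\}$. $I$ is a nonempty index set, $\{\mathbf{r}_i\}_{i\in I}\subseteq X$ is a bounded indexed set of points (sensors), $\mathbf{s}\in X$ (the source) and $t_0\in\mathbb{R}$ are fixed, and $t_i=t_0+\rho(\mathbf{r}_i;\mathbf{s})$ for $i\in I$. A point $\mathbf{s}'\in X$ is a solution of the SRP $(\{\mathbf{r}_i\};\{t_i\})$ if there is $t'\in\mathbb{R}$ with $t_i=t'+\rho(\mathbf{r}_i;\mathbf{s}')$ for all $i\in I$. Standing assumption: $\mathbf{s}$ is the unique solution in $X$. Defect. For $\mathbf{x}\in X$, $\tau_i(\mathbf{x})=t_i-\rho(\mathbf{x};\mathbf{r}_i)$, and $D_\infty(\mathbf{x})=\sup_{i,j\in I}|\tau_i(\mathbf{x})-\tau_j(\mathbf{x})|$. If $I=\{1,\dots,n\}$ or $I=\mathbb{N}$, then also $D_1(\mathbf{x})=\sum_{i\in I}p_i\bigl|\tau_i(\mathbf{x})-\sum_{j\in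 I}p_j\tau_j(\mathbf{x})\bigr|$, where $\{p_i\}_{i\in I}$ is a fixed family with $p_i>0$, $\sum_{i\in I}p_i=1$. $D$ denotes either $D_\infty$ or $D_1$ (the latter only when it is defined), the same choice for all $\mathbf{x}$. SDN property. $A\subseteq X$ has the SDN property if: $\mathbf{s}\in A$ implies that for every $\delta>0$, $\inf_{\mathbf{x}\in A\setminus B(\mathbf{s};\delta)}D(\mathbf{x})>0$ (with $\inf\varnothing=+\infty$). Covershape. A covershape is given by a set $S\subseteq X$ of admissible anchors and an assignment of a set (coverand) $C[\mathbf{x};r]$ to each anchor $\mathbf{x}\in S$ and size $r>0$, with $\mathbf{x}\in C[\mathbf{x};r]\subseteq B[\mathbf{x};r]\cap S$. A covershape is fixed that satisfies: (i) every coverand $C[\mathbf{c};r]$ has a finite cover by coverands $C[\mathbf{c}_i;\frac r2]$ with $\mathbf{c}_i\in C[\mathbf{c};r]$; (ii) for every coverand $C[\mathbf{c};r]$, putting $F_0=C[\mathbf{c};r]$, $F_k=\bigcup_{\mathbf{x}\in F_{k-1}}C[\mathbf{x};\frac{r}{2^k}]$ for $k\geq1$, the set $F_\infty=\bigcup_{k\geq0}F_k$ has the SDN property. Moreover, (iii) a coverand $C[\mathbf{c};r]$ with $\mathbf{s}\in C[\mathbf{c};r]$ is given (known). Non-halting RC-algorithm. Coverands are recorded together with their anchors and sizes. Step 0. Let $k:=1$, $\mathfrak{C}_0:=\{C[\mathbf{c};r]\}$ (the given coverand), $r_k:=r/2^k$ for $k\ge0$. Step 1. Let $\mathfrak{C}_k:=\varnothing$.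 For each coverand $C=C[\mathbf{y};r_{k-1}]\in\mathfrak{C}_{k-1}$ take (by (i)) any finite cover of $C$ by coverands $C[\mathbf{z};r_k]$ with $\mathbf{z}\in C$; for each coverand $C[\mathbf{z};r_k]$ of this cover, add it to $\mathfrak{C}_k$ if $D(\mathbf{z})\leq 2r_k$. Step 2. Let $\mathbf{c}_k$ be the anchor of an arbitrarily chosen coverand from $\mathfrak{C}_k$. Step 3'. Let $k:=k+1$ and go to Step 1. *)

theory Defs
  imports "HOL-Analysis.Analysis"
begin

section \<open>The sound ranging problem\<close>

text \<open>The metric space \<open>X\<close> is a type of class \<^class>\<open>metric_space\<close>; the sensors are
  \<open>sen i\<close> for \<open>i \<in> I\<close>, and the data are the arrival times \<open>t i\<close>.\<close>

definition srp_solution ::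
    "'i set \<Rightarrow> ('i \<Rightarrow> 'a::metric_space) \<Rightarrow> ('i \<Rightarrow> real) \<Rightarrow> 'a \<Rightarrow> bool" where
  "srp_solution I sen t s' \<longleftrightarrow> (\<exists>t'::real. \<forall>i\<in>I. t i = t' + dist (sen i) s')"

definition tau :: "('i \<Rightarrow> 'a::metric_space) \<Rightarrow> ('i \<Rightarrow> real) \<Rightarrow> 'i \<Rightarrow> 'a \<Rightarrow> real" where
  "tau sen t i x = t i - dist x (sen i)"

text \<open>If \<open>I\<close> is nonempty and \<open>t i = t0 + dist (sen i) s\<close> on \<open>I\<close>, then
  \<open>\<bar>tau sen t i x - t0\<bar> \<le> dist x s\<close>. So the supremum in \<open>D_inf\<close> is that of a nonempty bounded
  set, and for nonnegative weights of total 1 both sums in \<open>D_one\<close> converge absolutely.\<close>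

definition D_inf :: "'i set \<Rightarrow> ('i \<Rightarrow> 'a::metric_space) \<Rightarrow> ('i \<Rightarrow> real) \<Rightarrow> 'a \<Rightarrow> real" where
  "D_inf I sen t x = (SUP (i, j)\<in>I \<times> I. \<bar>tau sen t i x - tau sen t j x\<bar>)"

definition D_one ::
    "'i set \<Rightarrow> ('i \<Rightarrow> real) \<Rightarrow> ('i \<Rightarrow> 'a::metric_space) \<Rightarrow> ('i \<Rightarrow> real) \<Rightarrow> 'a \<Rightarrow> real" where
  "D_one I p sen t x =
     (\<Sum>\<^sub>\<infinity>i\<in>I. p i * \<bar>tau sen t i x - (\<Sum>\<^sub>\<infinity>j\<in>I. p j * tau sen t j x)\<bar>)"

text \<open>The index sets \<open>{1,\<dots>,n}\<close> and \<open>\<nat>\<close> are, up to relabelling, the countable ones; the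
  unordered sums do not depend on the labelling.\<close>

definition is_defect ::
    "'i set \<Rightarrow> ('i \<Rightarrow> real) \<Rightarrow> ('i \<Rightarrow> 'a::metric_space) \<Rightarrow> ('i \<Rightarrow> real) \<Rightarrow> ('a \<Rightarrow> real) \<Rightarrow> bool" where
  "is_defect I p sen t D \<longleftrightarrow>
     D = D_inf I sen t \<or>
     (countable I \<and> (\<forall>i\<in>I. p i > 0) \<and> (p has_sum 1) I \<and> D = D_one I p sen t)"

text \<open>The infimum is taken in \<^typ>\<open>ereal\<close>, so that it is \<open>\<infinity>\<close> over the empty set.\<close>

definition SDN :: "('a::metric_space \<Rightarrow> real) \<Rightarrow> 'a \<Rightarrow> 'a set \<Rightarrow> bool" where
  "SDN D s A \<longleftrightarrow> (s \<in> A \<longrightarrow> (\<forall>\<delta>>0. (INF x\<in>A - ball s \<delta>. ereal (D x)) > 0))"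

section \<open>Covershapes\<close>

text \<open>Only the values \<open>C x r\<close> with \<open>x \<in> S\<close> and \<open>r > 0\<close> are coverands.\<close>

definition covershape :: "'a::metric_space set \<Rightarrow> ('a \<Rightarrow> real \<Rightarrow> 'a set) \<Rightarrow> bool" where
  "covershape S C \<longleftrightarrow> (\<forall>x\<in>S. \<forall>r>0. x \<in> C x r \<and> C x r \<subseteq> cball x r \<inter> S)"

text \<open>A finite cover of \<open>A\<close> by coverands of size \<open>r\<close> anchored in \<open>A\<close>, given by the set \<open>Z\<close>
  of anchors.\<close>

definition finite_cover :: "('a \<Rightarrow> real \<Rightarrow> 'a set) \<Rightarrow> 'a set \<Rightarrow> real \<Rightarrow> 'a set \<Rightarrow> bool" where
  "finite_cover C A r Z \<longleftrightarrow> finite Z \<and> Z \<subseteq> A \<and> A \<subseteq> (\<Union>z\<in>Z. C z r)"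

primrec F_set :: "('a \<Rightarrow> real \<Rightarrow> 'a set) \<Rightarrow> 'a \<Rightarrow> real \<Rightarrow> nat \<Rightarrow> 'a set" where
  "F_set C c r 0 = C c r"
| "F_set C c r (Suc k) = (\<Union>x\<in>F_set C c r k. C x (r / 2 ^ Suc k))"

section \<open>The non-halting RC-algorithm\<close>

text \<open>The collections \<open>\<CC>\<^sub>k\<close> consist of coverands recorded as pairs (anchor, size).
  \<open>rc_step C D \<rho> \<A> \<B>\<close> says that \<open>\<B>\<close> is a possible outcome of Step 1 applied to \<open>\<A>\<close> with new
  size \<open>\<rho>\<close>; \<open>Z\<close> is the choice of a cover for each recorded coverand.\<close>

definition rc_step ::
    "('a \<Rightarrow> real \<Rightarrow> 'a set) \<Rightarrow> ('a \<Rightarrow> real) \<Rightarrow> real \<Rightarrow> ('a \<times> real) set \<Rightarrow> ('a \<times> real) set \<Rightarrow> bool" where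
  "rc_step C D \<rho> \<A> \<B> \<longleftrightarrow>
     (\<exists>Z. (\<forall>(y, q)\<in>\<A>. finite_cover C (C y q) \<rho> (Z y q)) \<and>
          \<B> = {(z, \<rho>) | z. (\<exists>(y, q)\<in>\<A>. z \<in> Z y q) \<and> D z \<le> 2 * \<rho>})"

text \<open>\<open>rc_run C D c r K \<A> a\<close>: the iterations \<open>1, \<dots>, K\<close> have been carried out, starting from the
  coverand \<open>C c r\<close>, and produced the collections \<open>\<A> 0, \<dots>, \<A> K\<close> and the anchors
  \<open>a 1, \<dots>, a K\<close> (other values of \<open>\<A>\<close> and \<open>a\<close> are irrelevant).\<close>

definition rc_run ::
    "('a \<Rightarrow> real \<Rightarrow> 'a set) \<Rightarrow> ('a \<Rightarrow> real) \<Rightarrow> 'a \<Rightarrow> real \<Rightarrow> nat \<Rightarrow>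
     (nat \<Rightarrow> ('a \<times> real) set) \<Rightarrow> (nat \<Rightarrow> 'a) \<Rightarrow> bool" where
  "rc_run C D c r K \<A> a \<longleftrightarrow>
     \<A> 0 = {(c, r)} \<and>
     (\<forall>k\<in>{1..K}. rc_step C D (r / 2 ^ k) (\<A> (k - 1)) (\<A> k) \<and> a k \<in> fst ` \<A> k)"

definition rc_infinite_run ::
    "('a \<Rightarrow> real \<Rightarrow> 'a set) \<Rightarrow> ('a \<Rightarrow> real) \<Rightarrow> 'a \<Rightarrow> real \<Rightarrow>
     (nat \<Rightarrow> ('a \<times> real) set) \<Rightarrow> (nat \<Rightarrow> 'a) \<Rightarrow> bool" where
  "rc_infinite_run C D c r \<A> a \<longleftrightarrow> (\<forall>K. rc_run C D c r K \<A> a)"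

text \<open>No execution gets stuck: after any \<open>K\<close> iterations, Step 1 can be carried out, and whichever
  covers are taken in it, Step 2 has a coverand to choose from.\<close>

definition rc_never_stuck ::
    "('a \<Rightarrow> real \<Rightarrow> 'a set) \<Rightarrow> ('a \<Rightarrow> real) \<Rightarrow> 'a \<Rightarrow> real \<Rightarrow> bool" where
  "rc_never_stuck C D c r \<longleftrightarrow>
     (\<forall>K \<A> a. rc_run C D c r K \<A> a \<longrightarrow>
        (\<exists>\<B>. rc_step C D (r / 2 ^ Suc K) (\<A> K) \<B>) \<and>
        (\<forall>\<B>. rc_step C D (r / 2 ^ Suc K) (\<A> K) \<B> \<longrightarrow> \<B> \<noteq> {}))"

end

(*  The defect satisfies D x <= 2 * dist x s.  Hence Step 1 never discards a coverand that contains
    s, so each collection contains one.  On the other hand every selected anchor lies in F_infinity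
    and has defect at most 2 * r_k, which tends to 0, so the SDN property of F_infinity forces the
    anchors towards s. *)

theory Submission
  imports Defs
begin

text \<open>Inserting \<open>t i\<close> turns the difference into
  \<open>dist (sen i) s - dist x (sen i)\<close>, so this is the reverse triangle inequality.
  Measuring against the common value \<open>t0\<close> lets one estimate serve both kinds of
  defect.\<close>

lemma abs_tau_diff_le_dist:
  assumes "t i = t0 + dist (sen i) s"
  shows "\<bar>tau sen t i x - t0\<bar> \<le> dist x s"
  using assms dist_triangle[of "sen i" s x] dist_triangle[of x "sen i" s]
  unfolding tau_def by (simp add: dist_commute)

lemma D_inf_le:
  assumes "I \<noteq> {}"
    and "\<And>i. i \<in> I \<Longrightarrow> \<bar>tau sen t i x - t0\<bar> \<le> d"
  shows "D_inf I sen t x \<le> 2 * d"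
  unfolding D_inf_def
proof (rule cSUP_least)
  show "I \<times> I \<noteq> {}" using assms(1) by simp
  fix ij assume "ij \<in> I \<times> I"
  then obtain i j where "ij = (i, j)" "i \<in> I" "j \<in> I" by blast
  then show "(case ij of (i, j) \<Rightarrow> \<bar>tau sen t i x - tau sen t j x\<bar>) \<le> 2 * d"
    using assms(2)[of i] assms(2)[of j] by simp
qed

text \<open>Comparison with the family \<open>p i * b\<close>, which sums to \<open>b\<close>
  because the total weight is 1. Summability is stated as well, since it is needed to split the sum
  for the mean.\<close>

lemma weighted_infsum_le:
  fixes p f :: "'i \<Rightarrow> real"
  assumes pos: "\<And>i. i \<in> I \<Longrightarrow> p i \<ge> 0"
    and sum: "(p has_sum 1) I"
    and bound: "\<And>i. i \<in> I \<Longrightarrow> \<bar>f i\<bar> \<le> b"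
  shows "(\<lambda>i. p i * f i) summable_on I" "\<bar>\<Sum>\<^sub>\<infinity>i\<in>I. p i * f i\<bar> \<le> b"
proof -
  have has: "((\<lambda>i. p i * b) has_sum b) I"
    using has_sum_cmult_left[OF sum, of b] by simp
  have le: "norm (p i * f i) \<le> p i * b" if "i \<in> I" for i
    using mult_left_mono[OF bound[OF that] pos[OF that]] pos[OF that] by (simp add: abs_mult)
  have abs: "(\<lambda>i. norm (p i * f i)) summable_on I"
    by (rule summable_on_comparison_test[OF has_sum_imp_summable[OF has]]) (use le in auto)
  then show "(\<lambda>i. p i * f i) summable_on I"
    by (rule abs_summable_summable)
  have "norm (\<Sum>\<^sub>\<infinity>i\<in>I. p i * f i) \<le> (\<Sum>\<^sub>\<infinity>i\<in>I. norm (p i * f i))"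
    by (rule norm_infsum_bound[OF abs])
  also have "\<dots> \<le> (\<Sum>\<^sub>\<infinity>i\<in>I. p i * b)"
    by (rule infsum_mono[OF abs has_sum_imp_summable[OF has] le])
  also have "\<dots> = b"
    using has by (rule infsumI)
  finally show "\<bar>\<Sum>\<^sub>\<infinity>i\<in>I. p i * f i\<bar> \<le> b" by simp
qed

text \<open>A weighted mean of values within \<open>d\<close> of \<open>t0\<close> is itself within
  \<open>d\<close> of \<open>t0\<close>. Hence every deviation from the mean is at most
  \<open>2 * d\<close>, and so is the average of these deviations.\<close>

lemma D_one_le:
  assumes pos: "\<And>i. i \<in> I \<Longrightarrow> p i \<ge> 0"
    and sum: "(p has_sum 1) I"
    and tau: "\<And>i. i \<in> I \<Longrightarrow> \<bar>tau sen t i x - t0\<bar> \<le> d"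
  shows "D_one I p sen t x \<le> 2 * d"
proof -
  define m where "m = (\<Sum>\<^sub>\<infinity>j\<in>I. p j * tau sen t j x)"
  note dev = weighted_infsum_le[where f = "\<lambda>i. tau sen t i x - t0", OF pos sum tau]
  \<comment> \<open>Split off the constant \<open>t0\<close>: the centred part is summable by
    \<open>dev(1)\<close>, and the rest contributes \<open>t0\<close> because the weights sum to
    1.\<close>
  have "((\<lambda>i. p i * (tau sen t i x - t0) + p i * t0) has_sum
      (\<Sum>\<^sub>\<infinity>i\<in>I. p i * (tau sen t i x - t0)) + 1 * t0) I"
    by (intro has_sum_add has_sum_infsum has_sum_cmult_left dev(1) sum)
  then have "m = (\<Sum>\<^sub>\<infinity>i\<in>I. p i * (tau sen t i x - t0)) + t0"
    unfolding m_def by (intro infsumI) (simp add: algebra_simps)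
  then have mean: "\<bar>m - t0\<bar> \<le> d" using dev(2) by simp
  have "\<bar>\<Sum>\<^sub>\<infinity>i\<in>I. p i * \<bar>tau sen t i x - m\<bar>\<bar> \<le> 2 * d"
  proof (rule weighted_infsum_le(2)[OF pos sum])
    fix i assume "i \<in> I"
    show "\<bar>\<bar>tau sen t i x - m\<bar>\<bar> \<le> 2 * d" using tau[OF \<open>i \<in> I\<close>] mean by simp
  qed
  then show ?thesis unfolding D_one_def m_def by simp
qed

lemma defect_le:
  assumes "I \<noteq> {}"
    and "\<And>i. i \<in> I \<Longrightarrow> t i = t0 + dist (sen i) s"
    and "is_defect I p sen t D"
  shows "D x \<le> 2 * dist x s"
proof -
  have tau: "\<bar>tau sen t i x - t0\<bar> \<le> dist x s" if "i \<in> I" for i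
    using abs_tau_diff_le_dist assms(2)[OF that] .
  from assms(3) show ?thesis
    unfolding is_defect_def
    using D_inf_le[OF assms(1) tau] D_one_le[OF _ _ tau, of I p] by (auto intro: less_imp_le)
qed

text \<open>The infimum may be infinite, so a real \<open>e\<close> strictly between 0 and it is
  chosen. This also covers the case where no point of \<open>A\<close> lies outside the
  ball.\<close>

lemma SDN_lower_bound:
  assumes "SDN D s A" "s \<in> A" "\<delta> > 0"
  obtains e where "e > 0" "\<And>x. x \<in> A \<Longrightarrow> dist x s \<ge> \<delta> \<Longrightarrow> e < D x"
proof -
  have "0 < (INF x\<in>A - ball s \<delta>. ereal (D x))"
    using assms unfolding SDN_def by blast
  then obtain e where e: "0 < ereal e" "ereal e < (INF x\<in>A - ball s \<delta>. ereal (D x))"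
    using ereal_dense2 by blast
  show thesis
  proof
    show "e > 0" using e(1) by simp
    fix x assume "x \<in> A" "dist x s \<ge> \<delta>"
    then have "x \<in> A - ball s \<delta>" by (simp add: dist_commute)
    then have "(INF x\<in>A - ball s \<delta>. ereal (D x)) \<le> ereal (D x)" by (rule INF_lower)
    with e(2) have "ereal e < ereal (D x)" by (rule less_le_trans)
    then show "e < D x" by simp
  qed
qed

lemma rc_step_exists:
  assumes "\<And>y q. (y, q) \<in> \<A> \<Longrightarrow> \<exists>Z. finite_cover C (C y q) \<rho> Z"
  shows "\<exists>\<B>. rc_step C D \<rho> \<A> \<B>"
proof -
  \<comment> \<open>Covers are chosen for all pairs at once; values of \<open>Z\<close> outside
    \<open>\<A>\<close> do not matter.\<close>
  define Z where "Z y q = (SOME Z. finite_cover C (C y q) \<rho> Z)" for y q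
  have "\<forall>(y, q)\<in>\<A>. finite_cover C (C y q) \<rho> (Z y q)"
    using assms unfolding Z_def by (auto intro: someI_ex)
  then show ?thesis unfolding rc_step_def by blast
qed

lemma rc_step_anchor:
  assumes "rc_step C D \<rho> \<A> \<B>" "(z, q') \<in> \<B>"
  obtains y q where "(y, q) \<in> \<A>" "z \<in> C y q" "q' = \<rho>" "D z \<le> 2 * \<rho>"
  using assms unfolding rc_step_def finite_cover_def by fast

text \<open>Some member of the cover contains \<open>s\<close>. Its anchor is within
  \<open>\<rho>\<close> of \<open>s\<close>, so the defect bound gives exactly the threshold
  \<open>2 * \<rho>\<close> of the test.\<close>

lemma rc_step_keeps_source:
  assumes shape: "covershape S C" and defect: "\<And>x. D x \<le> 2 * dist x s"
    and step: "rc_step C D \<rho> \<A> \<B>" and "\<rho> > 0"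
    and yq: "(y, q) \<in> \<A>" "s \<in> C y q" "C y q \<subseteq> S"
  obtains z where "(z, \<rho>) \<in> \<B>" "s \<in> C z \<rho>"
proof -
  obtain Z where Z: "\<forall>(y, q)\<in>\<A>. finite_cover C (C y q) \<rho> (Z y q)"
    and \<B>: "\<B> = {(z, \<rho>) | z. (\<exists>(y, q)\<in>\<A>. z \<in> Z y q) \<and> D z \<le> 2 * \<rho>}"
    using step unfolding rc_step_def by blast
  have "finite_cover C (C y q) \<rho> (Z y q)" using Z yq(1) by blast
  then obtain z where z: "z \<in> Z y q" "s \<in> C z \<rho>" "z \<in> C y q"
    using yq(2) unfolding finite_cover_def by blast
  then have "s \<in> cball z \<rho>"
    using shape yq(3) \<open>\<rho> > 0\<close> unfolding covershape_def by blast
  then have "D z \<le> 2 * \<rho>" using defect[of z] by simp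
  then have "(z, \<rho>) \<in> \<B>" using z(1) yq(1) \<B> by blast
  with z(2) show thesis using that by blast
qed

text \<open>The first part locates the anchors in \<open>S\<close>, where the covershape conditions
  apply, and the coverands in the \<open>k\<close>-th set, as the SDN property requires; the second
  guarantees that the collection is nonempty.\<close>

lemma rc_run_invariant:
  assumes shape: "covershape S C" and defect: "\<And>x. D x \<le> 2 * dist x s"
    and c: "c \<in> S" "r > 0" "s \<in> C c r"
    and run: "rc_run C D c r K \<A> a" and "k \<le> K"
  shows "(\<forall>(y, q)\<in>\<A> k. q = r / 2 ^ k \<and> y \<in> S \<and> C y q \<subseteq> F_set C c r k) \<and>
    (\<exists>(y, q)\<in>\<A> k. s \<in> C y q)"
  using \<open>k \<le> K\<close>
proof (induction k)
  case 0
  then show ?case using run c unfolding rc_run_def by simp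
next
  case (Suc k)
  let ?\<rho> = "r / 2 ^ Suc k"
  have IH: "q = r / 2 ^ k \<and> y \<in> S \<and> C y q \<subseteq> F_set C c r k" if "(y, q) \<in> \<A> k" for y q
    using Suc that by auto
  have sub: "C y q \<subseteq> S" if "(y, q) \<in> \<A> k" for y q
    using IH[OF that] shape \<open>r > 0\<close> unfolding covershape_def by simp
  have step: "rc_step C D ?\<rho> (\<A> k) (\<A> (Suc k))"
    using run Suc.prems unfolding rc_run_def by (auto dest: bspec[of _ _ "Suc k"])
  have "q' = ?\<rho> \<and> z \<in> S \<and> C z q' \<subseteq> F_set C c r (Suc k)" if zq: "(z, q') \<in> \<A> (Suc k)" for z q'
  proof -
    obtain y q where y: "(y, q) \<in> \<A> k" "z \<in> C y q" "q' = ?\<rho>"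
      using rc_step_anchor[OF step zq] by metis
    \<comment> \<open>The new anchor lies in an old coverand, hence in the \<open>k\<close>-th set;
      its coverand is then one of those whose union is the next set.\<close>
    then have "z \<in> F_set C c r k" "z \<in> S" using IH[of y q] sub[of y q] by auto
    with y(3) show ?thesis by auto
  qed
  moreover obtain y q where "(y, q) \<in> \<A> k" "s \<in> C y q" using Suc by auto
  then obtain z where "(z, ?\<rho>) \<in> \<A> (Suc k)" "s \<in> C z ?\<rho>"
    using rc_step_keeps_source[OF shape defect step _ _ _ sub] \<open>r > 0\<close> by auto
  ultimately show ?case by blast
qed

text \<open>By the invariant all recorded sizes equal \<open>r / 2 ^ K\<close>, so covers by
  coverands of half the size are the ones Step 1 asks for. Whichever are taken, a coverand
  containing \<open>s\<close> survives.\<close>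

lemma rc_never_stuckI:
  assumes shape: "covershape S C" and defect: "\<And>x. D x \<le> 2 * dist x s"
    and cover: "\<And>x q. x \<in> S \<Longrightarrow> q > 0 \<Longrightarrow> \<exists>Z. finite_cover C (C x q) (q / 2) Z"
    and c: "c \<in> S" "r > 0" "s \<in> C c r"
  shows "rc_never_stuck C D c r"
  unfolding rc_never_stuck_def
proof (intro allI impI conjI)
  fix K \<A> a assume run: "rc_run C D c r K \<A> a"
  note inv = rc_run_invariant[OF shape defect c run order_refl]
  show "\<exists>\<B>. rc_step C D (r / 2 ^ Suc K) (\<A> K) \<B>"
  proof (rule rc_step_exists)
    fix y q assume "(y, q) \<in> \<A> K"
    then have "q = r / 2 ^ K" "y \<in> S" using inv by auto
    moreover from this have "q / 2 = r / 2 ^ Suc K" "q > 0" using \<open>r > 0\<close> by simp_all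
    ultimately show "\<exists>Z. finite_cover C (C y q) (r / 2 ^ Suc K) Z"
      using cover[of y q] by metis
  qed
  fix \<B> assume step: "rc_step C D (r / 2 ^ Suc K) (\<A> K) \<B>"
  obtain y q where y: "(y, q) \<in> \<A> K" "s \<in> C y q" using inv by auto
  then have "q = r / 2 ^ K" "y \<in> S" using inv by auto
  then have "C y q \<subseteq> S" using shape \<open>r > 0\<close> unfolding covershape_def by simp
  then show "\<B> \<noteq> {}"
    using rc_step_keeps_source[OF shape defect step _ y] \<open>r > 0\<close> by auto
qed

text \<open>An anchor belongs to its own coverand, which the invariant places in the
  \<open>k\<close>-th set; the defect bound is the test that the coverand has passed.\<close>

lemma rc_run_anchor:
  assumes shape: "covershape S C" and defect: "\<And>x. D x \<le> 2 * dist x s"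
    and c: "c \<in> S" "r > 0" "s \<in> C c r"
    and run: "rc_run C D c r K \<A> a" and k: "k \<in> {1..K}"
  shows "a k \<in> F_set C c r k" "D (a k) \<le> 2 * (r / 2 ^ k)"
proof -
  obtain q where q: "(a k, q) \<in> \<A> k"
    using run k unfolding rc_run_def by fastforce
  have "q = r / 2 ^ k \<and> a k \<in> S \<and> C (a k) q \<subseteq> F_set C c r k"
    using rc_run_invariant[OF shape defect c run, of k] q k by auto
  then show "a k \<in> F_set C c r k"
    using shape \<open>r > 0\<close> unfolding covershape_def by auto
  have "rc_step C D (r / 2 ^ k) (\<A> (k - 1)) (\<A> k)"
    using run k unfolding rc_run_def by blast
  then show "D (a k) \<le> 2 * (r / 2 ^ k)"
    using q by (rule rc_step_anchor)
qed

theorem mainTheorem2: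
  fixes I :: "'i set" and sen :: "'i \<Rightarrow> 'a::metric_space" and t p :: "'i \<Rightarrow> real"
    and s c :: 'a and t0 r :: real and D :: "'a \<Rightarrow> real"
    and S :: "'a set" and C :: "'a \<Rightarrow> real \<Rightarrow> 'a set"
  assumes "I \<noteq> {}"
    and "bounded (sen ` I)"
    and "\<And>i. i \<in> I \<Longrightarrow> t i = t0 + dist (sen i) s"
    and "{s'. srp_solution I sen t s'} = {s}"
    and "is_defect I p sen t D"
    and "covershape S C"
    and "\<And>x q. x \<in> S \<Longrightarrow> q > 0 \<Longrightarrow> \<exists>Z. finite_cover C (C x q) (q / 2) Z"
    and "\<And>x q. x \<in> S \<Longrightarrow> q > 0 \<Longrightarrow> SDN D s (\<Union>k. F_set C x q k)"
    and "c \<in> S" and "r > 0" and "s \<in> C c r"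
  shows "rc_never_stuck C D c r \<and>
    (\<forall>\<A> a. rc_infinite_run C D c r \<A> a \<longrightarrow> a \<longlonglongrightarrow> s)"
proof (intro conjI allI impI)
  have defect: "D x \<le> 2 * dist x s" for x
    using defect_le[OF assms(1,3,5)] .
  show "rc_never_stuck C D c r"
    using rc_never_stuckI[OF assms(6) defect assms(7,9-11)] .
  fix \<A> a assume "rc_infinite_run C D c r \<A> a"
  then have run: "rc_run C D c r k \<A> a" for k
    unfolding rc_infinite_run_def by blast
  \<comment> \<open>Index 0 is excluded because a run does not constrain \<open>a 0\<close>.\<close>
  have anchor: "a k \<in> (\<Union>k. F_set C c r k)" "D (a k) \<le> 2 * (r / 2 ^ k)" if "k \<ge> 1" for k
    using rc_run_anchor[OF assms(6) defect assms(9-11) run[of k], of k] that by auto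
  \<comment> \<open>The SDN property is conditional on \<open>s\<close> belonging to the union, so
    this premise has to be discharged.\<close>
  have "s \<in> F_set C c r 0" using assms(11) by simp
  then have s: "s \<in> (\<Union>k. F_set C c r k)" by blast
  have lim: "(\<lambda>k. 2 * (r / 2 ^ k)) \<longlonglongrightarrow> 0"
    using tendsto_mult_right_zero[OF LIMSEQ_divide_realpow_zero[of 2 r], of 2] by simp
  show "a \<longlonglongrightarrow> s"
  proof (rule tendstoI)
    fix \<delta> :: real assume "\<delta> > 0"
    obtain e where e: "e > 0" "\<And>x. x \<in> (\<Union>k. F_set C c r k) \<Longrightarrow> dist x s \<ge> \<delta> \<Longrightarrow> e < D x"
      using SDN_lower_bound[OF assms(8)[OF assms(9,10)] s \<open>\<delta> > 0\<close>] by blast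
    have "\<forall>\<^sub>F k in sequentially. 2 * (r / 2 ^ k) < e"
      using order_tendstoD(2)[OF lim \<open>e > 0\<close>] .
    moreover have "\<forall>\<^sub>F k in sequentially. k \<ge> 1" by (rule eventually_ge_at_top)
    ultimately show "\<forall>\<^sub>F k in sequentially. dist (a k) s < \<delta>"
    proof eventually_elim
      case (elim k)
      \<comment> \<open>An anchor at distance at least \<open>\<delta>\<close> from \<open>s\<close>
        would have defect above \<open>e\<close>, but its defect is at most
        \<open>2 * (r / 2 ^ k)\<close>, which is now below \<open>e\<close>.\<close>
      show ?case using e(2)[of "a k"] anchor[of k] elim by force
    qed
  qed
qed

end
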